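(* There is a Type I Tychonoff countably compact locally compact space $Y$ which is f-narrow in itself but not narrow in itself.
   Context: "Space" means Hausdorff topological space. The longray $\mathbb{L}_{\ge 0}$ is $\omega_1\times[0,1)$ with the lexicographic order topology; $\alpha\in\omega_1$ is identified with $\langle\alpha,0\rangle$. A function into $\mathbb{L}_{\ge 0}$ is bounded if its range is contained in a strict initial segment. A systematic cover of $Y$ indexed by $\omega_1$ is an open cover $\{U_\alpha:\alpha\in\omega_1\}$ with $\overline{U_\alpha}\subset U_\beta$ whenever $\alpha<\beta$. $Y$ is Type I if it has such a cover with every $\overline{U_\alpha}$ Lindelöf. $Y$ is narrow in itself if for every systematic cover $\{U_\alpha:\alpha\in\omega_1\}$ of $Y$, either $Y= U_\alpha$ for some $\alpha$ or $\overline{U_\alpha}$ is Lindelöf for each $\alpha$. $Y$ is f-narrow (functionally narrow) in itself if for every continuous $f:Y\to\mathbb{L}_{\ge 0}$, either $f$ is bounded or $f^{-1}([0,\alpha])$ is Lindelöf for each $\alpha\in\omega_1$. *)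

theory Defs
  imports "HOL-Analysis.Analysis"
begin

section \<open>The ordinal \<open>\<omega>\<^sub>1\<close>\<close>

text \<open>\<^term>\<open>cardSuc natLeq\<close> is the successor cardinal of \<open>\<aleph>\<^sub>0\<close>, represented as an initial
  well-order, i.e. a well-order of type \<open>\<omega>\<^sub>1\<close>.\<close>

typedef omega1 = "Field (cardSuc natLeq)"
proof -
  have "Field (cardSuc natLeq) \<noteq> {}"
    by (metis Field_natLeq cardSuc_finite finite.emptyI infinite_UNIV_nat natLeq_Card_order)
  then show ?thesis by blast
qed

lemma Well_order_omega1: "Well_order (cardSuc natLeq)"
  using cardSuc_Card_order[OF natLeq_Card_order] by (simp add: card_order_on_def)

instantiation omega1 :: linorder
begin

definition less_eq_omega1 :: "omega1 \<Rightarrow> omega1 \<Rightarrow> bool"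
  where "a \<le> b \<longleftrightarrow> (Rep_omega1 a, Rep_omega1 b) \<in> cardSuc natLeq"

definition less_omega1 :: "omega1 \<Rightarrow> omega1 \<Rightarrow> bool"
  where "a < b \<longleftrightarrow> a \<le> b \<and> a \<noteq> (b :: omega1)"

instance
proof
  have lin: "Linear_order (cardSuc natLeq)"
    using Well_order_omega1 by (simp add: well_order_on_def)
  then have anti: "antisym (cardSuc natLeq)" and tr: "trans (cardSuc natLeq)"
    and rf: "refl_on (Field (cardSuc natLeq)) (cardSuc natLeq)"
    and tot: "total_on (Field (cardSuc natLeq)) (cardSuc natLeq)"
    by (auto simp: order_on_defs)
  fix a b c :: omega1
  show r: "a \<le> a"
    using rf Rep_omega1[of a] by (auto simp: less_eq_omega1_def refl_on_def)
  show as: "a = b" if "a \<le> b" "b \<le> a"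
    using that anti by (auto simp: less_eq_omega1_def Rep_omega1_inject dest: antisymD)
  show "a \<le> c" if "a \<le> b" "b \<le> c"
    using that tr unfolding less_eq_omega1_def by (blast dest: transD)
  show "a \<le> b \<or> b \<le> a"
    using tot r Rep_omega1[of a] Rep_omega1[of b]
    by (metis less_eq_omega1_def total_on_def Rep_omega1_inject)
  show "(a < b) = (a \<le> b \<and> \<not> b \<le> a)"
    using as r by (auto simp: less_omega1_def)
qed

end

instance omega1 :: wellorder
proof
  fix P :: "omega1 \<Rightarrow> bool" and a
  assume step: "\<And>x. (\<And>y. y < x \<Longrightarrow> P y) \<Longrightarrow> P x"
  have "wf (cardSuc natLeq - Id)"
    using Well_order_omega1 by (simp add: well_order_on_def)
  then have "wf (inv_image (cardSuc natLeq - Id) Rep_omega1)"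
    by (rule wf_inv_image)
  then show "P a"
  proof (induction a rule: wf_induct_rule)
    case (less x)
    show ?case
    proof (rule step)
      fix y assume "y < x"
      then show "P y"
        by (intro less) (simp add: less_omega1_def less_eq_omega1_def Rep_omega1_inject)
    qed
  qed
qed

lemma countable_iff_ordLeq_natLeq: "countable A \<longleftrightarrow> (card_of A, natLeq) \<in> ordLeq"
proof -
  have "countable A \<longleftrightarrow> (card_of A, card_of (UNIV :: nat set)) \<in> ordLeq"
    unfolding countable_def card_of_ordLeq[symmetric] by auto
  then show ?thesis
    using card_of_nat ordLeq_ordIso_trans ordIso_symmetric by blast
qed

lemma uncountable_UNIV_omega1: "uncountable (UNIV :: omega1 set)"
proof
  include cardinal_syntax
  assume "countable (UNIV :: omega1 set)"
  then have "countable (Rep_omega1 ` UNIV)" by (rule countable_image)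
  also have "Rep_omega1 ` UNIV = Field (cardSuc natLeq)"
    by (rule type_definition.Rep_range[OF type_definition_omega1])
  finally have "|Field (cardSuc natLeq)| \<le>o natLeq"
    by (simp add: countable_iff_ordLeq_natLeq)
  moreover have "|Field (cardSuc natLeq)| =o cardSuc natLeq"
    by (rule card_of_Field_ordIso[OF cardSuc_Card_order[OF natLeq_Card_order]])
  ultimately have "cardSuc natLeq \<le>o natLeq"
    using ordIso_ordLeq_trans ordIso_symmetric by blast
  then show False
    using cardSuc_greater[OF natLeq_Card_order] not_ordLess_ordLeq by blast
qed

lemma countable_lessThan_omega1: "countable {..<a :: omega1}"
proof -
  include cardinal_syntax
  have C: "Card_order (cardSuc natLeq)"
    by (rule cardSuc_Card_order[OF natLeq_Card_order])
  have "Rep_omega1 ` {..<a} \<subseteq> underS (cardSuc natLeq) (Rep_omega1 a)"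
    by (auto simp: underS_def less_omega1_def less_eq_omega1_def Rep_omega1_inject)
  moreover have "|underS (cardSuc natLeq) (Rep_omega1 a)| <o cardSuc natLeq"
    by (rule card_of_underS[OF C Rep_omega1])
  then have "|underS (cardSuc natLeq) (Rep_omega1 a)| \<le>o natLeq"
    using cardSuc_ordLeq_ordLess[OF natLeq_Card_order card_of_Card_order] by blast
  then have "countable (underS (cardSuc natLeq) (Rep_omega1 a))"
    by (simp add: countable_iff_ordLeq_natLeq)
  ultimately have "countable (Rep_omega1 ` {..<a})"
    by (rule countable_subset)
  then show ?thesis
    by (rule countable_image_inj_on) (simp add: inj_on_def Rep_omega1_inject)
qed


section \<open>The longray\<close>

typedef longray = "{(a :: omega1, t :: real). 0 \<le> t \<and> t < 1}"
  by (rule exI[of _ "(undefined, 0)"]) simp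

instantiation longray :: linorder
begin

definition less_eq_longray :: "longray \<Rightarrow> longray \<Rightarrow> bool"
  where "x \<le> y \<longleftrightarrow> fst (Rep_longray x) < fst (Rep_longray y) \<or>
    fst (Rep_longray x) = fst (Rep_longray y) \<and> snd (Rep_longray x) \<le> snd (Rep_longray y)"

definition less_longray :: "longray \<Rightarrow> longray \<Rightarrow> bool"
  where "x < y \<longleftrightarrow> fst (Rep_longray x) < fst (Rep_longray y) \<or>
    fst (Rep_longray x) = fst (Rep_longray y) \<and> snd (Rep_longray x) < snd (Rep_longray y)"

instance
proof
  fix x y z :: longray
  show "(x < y) = (x \<le> y \<and> \<not> y \<le> x)"
    unfolding less_eq_longray_def less_longray_def by (metis less_asym less_irrefl less_le_not_le)
  show "x \<le> x"
    by (simp add: less_eq_longray_def)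
  show "x \<le> z" if "x \<le> y" "y \<le> z"
    using that unfolding less_eq_longray_def by (metis less_trans order_trans)
  show "x = y" if "x \<le> y" "y \<le> x"
    using that unfolding less_eq_longray_def
    by (metis Rep_longray_inject less_asym order_antisym prod_eqI)
  show "x \<le> y \<or> y \<le> x"
    unfolding less_eq_longray_def by (metis linear neqE)
qed

end

instantiation longray :: linorder_topology
begin

definition open_longray :: "longray set \<Rightarrow> bool"
  where "open_longray = generate_topology (range (\<lambda>a. {..<a}) \<union> range (\<lambda>a. {a<..}))"

instance
  by standard (rule open_longray_def)

end

definition longray_of :: "omega1 \<Rightarrow> longray"
  where "longray_of \<alpha> = Abs_longray (\<alpha>, 0)"


section \<open>Topological notions\<close>

definition tychonoff_space :: "'a topology \<Rightarrow> bool"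
  where "tychonoff_space Y \<longleftrightarrow> completely_regular_space Y \<and> Hausdorff_space Y"

text \<open>The library only has countable compactness for subsets of a type of class
  \<^class>\<open>topological_space\<close>.\<close>

definition countably_compact_space :: "'a topology \<Rightarrow> bool"
  where "countably_compact_space Y \<longleftrightarrow>
    (\<forall>\<U>. countable \<U> \<and> (\<forall>U\<in>\<U>. openin Y U) \<and> \<Union>\<U> = topspace Y \<longrightarrow>
      (\<exists>\<V>. finite \<V> \<and> \<V> \<subseteq> \<U> \<and> \<Union>\<V> = topspace Y))"

definition systematic_cover :: "'a topology \<Rightarrow> (omega1 \<Rightarrow> 'a set) \<Rightarrow> bool"
  where "systematic_cover Y U \<longleftrightarrow>
    (\<forall>\<alpha>. openin Y (U \<alpha>)) \<and> (\<Union>\<alpha>. U \<alpha>) = topspace Y \<and>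
    (\<forall>\<alpha> \<beta>. \<alpha> < \<beta> \<longrightarrow> Y closure_of (U \<alpha>) \<subseteq> U \<beta>)"

definition Type_I :: "'a topology \<Rightarrow> bool"
  where "Type_I Y \<longleftrightarrow>
    (\<exists>U. systematic_cover Y U \<and> (\<forall>\<alpha>. Lindelof_space (subtopology Y (Y closure_of (U \<alpha>)))))"

definition narrow_in_itself :: "'a topology \<Rightarrow> bool"
  where "narrow_in_itself Y \<longleftrightarrow>
    (\<forall>U. systematic_cover Y U \<longrightarrow>
      (\<exists>\<alpha>. topspace Y = U \<alpha>) \<or>
      (\<forall>\<alpha>. Lindelof_space (subtopology Y (Y closure_of (U \<alpha>)))))"

definition bounded_into_longray :: "'a topology \<Rightarrow> ('a \<Rightarrow> longray) \<Rightarrow> bool"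
  where "bounded_into_longray Y f \<longleftrightarrow> (\<exists>x. f ` topspace Y \<subseteq> {..<x})"

text \<open>The longray has least element \<open>0\<close>, so \<open>[0, \<alpha>]\<close> is the initial segment \<open>{..longray_of \<alpha>}\<close>.\<close>

definition f_narrow_in_itself :: "'a topology \<Rightarrow> bool"
  where "f_narrow_in_itself Y \<longleftrightarrow>
    (\<forall>f. continuous_map Y euclidean f \<longrightarrow>
      bounded_into_longray Y f \<or>
      (\<forall>\<alpha>. Lindelof_space (subtopology Y {y \<in> topspace Y. f y \<in> {..longray_of \<alpha>}})))"

end

theory Submission
  imports Defs
begin

text \<open>The space consists of \<open>\<omega>\<^sub>1\<close> compact rows; row \<open>y\<close> meets the edges \<open>E\<^sub>a\<close> with
  \<open>a \<le> y\<close>. Between \<open>E\<^sub>a\<close> and \<open>E\<^sub>a\<^sub>+\<^sub>1\<close> lies a copy of the half-plank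
  \<open>{(x, y). y \<le> x \<le> \<omega>\<^sub>1}\<close>, with \<open>E\<^sub>a\<close> the diagonal and \<open>E\<^sub>a\<^sub>+\<^sub>1\<close> the line \<open>x = \<omega>\<^sub>1\<close>.
  A longray-valued continuous function is constant near \<open>x = \<omega>\<^sub>1\<close> on each row; by a closing-off argument
  its values on the two edges of each half-plank agree on cofinally many rows, hence it is constant
  on cofinally many entire rows. If \<open>f\<close> were unbounded with some \<open>f\<^sup>-\<^sup>1[0, l]\<close> not Lindelof, then for
  \<open>m > l\<close> both values \<open>\<ge> m\<close> and values \<open>\<le> l\<close> would occur on cofinally many rows, and a constant row
  that is a limit of rows of either kind would give \<open>m \<le> l\<close>. On the other hand the sets lying
  strictly before \<open>E\<^sub>a\<close> form a systematic cover with non-Lindelof closures, because adjacent edges,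
  although not functionally separated, are disjoint closed sets.

  The rows fit together as a well-founded meet-semilattice, and the topology that makes all principal
  ideals clopen is automatically Hausdorff with compact principal ideals.\<close>

section \<open>Countable suprema in \<open>\<omega>\<^sub>1\<close>\<close>

text \<open>Otherwise \<open>omega1\<close> would be a countable union of countable initial
  segments.\<close>

lemma countable_bounded_omega1:
  fixes B :: "omega1 set"
  assumes "countable B"
  shows "\<exists>a. \<forall>b\<in>B. b < a"
proof (rule ccontr)
  assume "\<not> ?thesis"
  then have "\<forall>a. \<exists>b\<in>B. a \<le> b" by (meson not_less)
  then have "UNIV = (\<Union>b\<in>B. insert b {..<b})" by (auto simp: order_le_less)
  moreover have "countable (\<Union>b\<in>B. insert b {..<b})"
    using assms by (intro countable_UN) (simp_all add: countable_lessThan_omega1)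
  ultimately show False using uncountable_UNIV_omega1 by simp
qed

lemma ex_greater_omega1: "\<exists>b. a < (b :: omega1)"
  using countable_bounded_omega1[of "{a}"] by simp

instance omega1 :: no_top
  by standard (rule ex_greater_omega1)

definition succ :: "omega1 \<Rightarrow> omega1"
  where "succ a = (LEAST b. a < b)"

lemma less_succ_iff: "c < succ a \<longleftrightarrow> c \<le> a"
proof -
  have "a < succ a"
    unfolding succ_def using ex_greater_omega1 by (rule LeastI_ex)
  moreover have "\<not> a < c" if "c < succ a"
    using not_less_Least that unfolding succ_def by blast
  ultimately show ?thesis by (meson not_le le_less_trans)
qed

lemma less_succ [simp]: "a < succ a"
  by (simp add: less_succ_iff)

lemma succ_le_iff: "succ a \<le> c \<longleftrightarrow> a < c"
  using less_succ_iff[of c a] by (auto simp: not_less[symmetric])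

lemma strict_seq_limit_omega1:
  fixes Y :: "nat \<Rightarrow> omega1"
  assumes "\<And>n. Y n < Y (Suc n)"
  obtains y where "\<And>n. Y n < y" "\<And>w. w < y \<Longrightarrow> eventually (\<lambda>n. w < Y n) sequentially"
proof -
  have mono: "mono Y" using assms by (intro mono_iff_le_Suc[THEN iffD2]) (simp add: less_imp_le)
  obtain u where u: "\<forall>b\<in>range Y. b < u" using countable_bounded_omega1[of "range Y"] by auto
  define y where "y = (LEAST u. \<forall>n. Y n < u)"
  have "\<forall>n. Y n < y" unfolding y_def by (rule LeastI[of _ u]) (use u in auto)
  moreover have "eventually (\<lambda>n. w < Y n) sequentially" if "w < y" for w
  proof -
    obtain n where "\<not> Y n < w" using not_less_Least \<open>w < y\<close> unfolding y_def by blast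
    \<comment> \<open>Minimality of \<open>y\<close> gives only \<open>w \<le> Y n\<close>; one more
      term makes it strict.\<close>
    then have "w < Y (Suc n)" using assms[of n] by (simp add: not_less)
    then have "\<forall>m\<ge>Suc n. w < Y m" using monoD[OF mono] by (meson less_le_trans)
    then show ?thesis by (auto simp: eventually_sequentially)
  qed
  ultimately show ?thesis using that by blast
qed

section \<open>Placing the triples inside \<open>real set\<close>\<close>

lemma infinite_UNIV_omega1: "infinite (UNIV :: omega1 set)"
  using uncountable_UNIV_omega1 uncountable_infinite by blast

text \<open>By Cantor's theorem \<open>real set\<close> has cardinality above aleph_0, hence at
  least aleph_1, and aleph_1 absorbs squares. So the space can live on the type
  \<open>real set\<close>.\<close>

lemma ex_inj_omega1_triples: "\<exists>j :: omega1 \<times> omega1 \<times> omega1 \<Rightarrow> real set. inj j"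
proof -
  include cardinal_syntax
  have C: "Card_order (cardSuc natLeq)"
    by (rule cardSuc_Card_order[OF natLeq_Card_order])
  have "|UNIV :: (omega1 \<times> omega1) set| \<le>o |UNIV :: omega1 set|"
    using card_of_Times_same_infinite[OF infinite_UNIV_omega1] ordIso_imp_ordLeq by simp
  then obtain h :: "omega1 \<times> omega1 \<Rightarrow> omega1" where h: "inj h"
    using card_of_ordLeq[of "UNIV :: (omega1 \<times> omega1) set" "UNIV :: omega1 set"] by auto
  have "bij_betw Rep_omega1 UNIV (Field (cardSuc natLeq))"
    by (simp add: bij_betw_def type_definition.Rep_range[OF type_definition_omega1]
        inj_def Rep_omega1_inject)
  then have "|UNIV :: omega1 set| =o |Field (cardSuc natLeq)|"
    using card_of_ordIso by blast
  then have o1: "|UNIV :: omega1 set| =o cardSuc natLeq"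
    using card_of_Field_ordIso[OF C] ordIso_transitive by blast
  have "|UNIV :: nat set| \<le>o |UNIV :: real set|"
    by (rule card_of_ordLeqI[of real]) (simp_all add: inj_of_nat)
  then have "natLeq \<le>o |UNIV :: real set|"
    using card_of_nat ordIso_ordLeq_trans ordIso_symmetric by blast
  moreover have "|UNIV :: real set| <o |UNIV :: real set set|"
    using card_of_Pow[of "UNIV :: real set"] by simp
  ultimately have "natLeq <o |UNIV :: real set set|"
    using ordLeq_ordLess_trans by blast
  then have "cardSuc natLeq \<le>o |UNIV :: real set set|"
    using cardSuc_ordLess_ordLeq[OF natLeq_Card_order card_of_Card_order] by blast
  then have "|UNIV :: omega1 set| \<le>o |UNIV :: real set set|"
    using o1 ordIso_ordLeq_trans by blast
  then obtain i :: "omega1 \<Rightarrow> real set" where i: "inj i"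
    using card_of_ordLeq[of "UNIV :: omega1 set" "UNIV :: real set set"] by auto
  have "inj (\<lambda>(a, b, c). i (h (a, h (b, c))))"
    by (auto intro!: injI dest!: injD[OF h] injD[OF i])
  then show ?thesis by blast
qed

section \<open>The longray\<close>

lemma Rep_Abs_longray: "0 \<le> t \<Longrightarrow> t < 1 \<Longrightarrow> Rep_longray (Abs_longray (a, t)) = (a, t)"
  by (simp add: Abs_longray_inverse)

lemma ex_greater_longray: "\<exists>y. x < (y :: longray)"
proof -
  obtain a t where x: "Rep_longray x = (a, t)" by fastforce
  obtain b where "a < b" using ex_greater_omega1 by blast
  then have "x < Abs_longray (b, 0)" by (simp add: less_longray_def x Rep_Abs_longray)
  then show ?thesis ..
qed

text \<open>Open rays whose endpoints have first coordinate at most that of \<open>c\<close> and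
  rational second coordinate are countably many, and they already separate \<open>c\<close> from
  every other point.\<close>

lemma longray_point_countable_pseudocharacter:
  fixes c :: longray
  shows "\<exists>\<V>. countable \<V> \<and> (\<forall>V\<in>\<V>. open V \<and> c \<in> V) \<and> \<Inter>\<V> = {c}"
proof -
  obtain a t where c: "Rep_longray c = (a, t)" by fastforce
  then have t: "0 \<le> t" "t < 1" using Rep_longray[of c] by auto
  define R where "R = (\<lambda>(b, q). Abs_longray (b, q)) ` ({..a} \<times> {q \<in> \<rat>. 0 \<le> q \<and> q < 1})"
  have "countable {..a}"
    using countable_lessThan_omega1[of "succ a"] by (simp add: lessThan_def atMost_def less_succ_iff)
  moreover have "countable {q \<in> \<rat>. 0 \<le> q \<and> q < (1 :: real)}"
    by (rule countable_subset[OF _ countable_rat]) auto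
  ultimately have "countable R" unfolding R_def by blast
  have lo: "\<exists>r\<in>R. z \<le> r \<and> r < c" if "z < c" for z
  proof -
    obtain b s where z: "Rep_longray z = (b, s)" by fastforce
    then have s: "0 \<le> s" "s < 1" using Rep_longray[of z] by auto
    have "b \<le> a" using that z c by (auto simp: less_longray_def)
    \<comment> \<open>\<open>m\<close> limits the second coordinates in column \<open>b\<close> of
      points below \<open>c\<close>: the whole column is free if \<open>b < a\<close>, only the part
      below \<open>t\<close> if \<open>b = a\<close>.\<close>
    define m where "m = (if b < a then 1 else t)"
    have "s < m" "m \<le> 1" using that z c s t by (auto simp: less_longray_def m_def)
    then obtain q where q: "q \<in> \<rat>" "s < q" "q < m" using Rats_dense_in_real by blast
    have q01: "0 \<le> q" "q < 1" using q s \<open>m \<le> 1\<close> by auto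
    have "Abs_longray (b, q) \<in> R" using q q01 \<open>b \<le> a\<close> by (auto simp: R_def)
    moreover have "z \<le> Abs_longray (b, q)" "Abs_longray (b, q) < c"
      using q q01 z c \<open>b \<le> a\<close>
      by (auto simp: less_eq_longray_def less_longray_def Rep_Abs_longray m_def split: if_splits)
    ultimately show ?thesis by blast
  qed
  have hi: "\<exists>r\<in>R. r \<le> z \<and> c < r" if "c < z" for z
  proof -
    obtain b s where z: "Rep_longray z = (b, s)" by fastforce
    then have s: "0 \<le> s" "s < 1" using Rep_longray[of z] by auto
    have "a \<le> b" using that z c by (auto simp: less_longray_def)
    \<comment> \<open>Here the rational is sought in column \<open>a\<close> above \<open>t\<close>;
      \<open>s\<close> bounds it only when \<open>z\<close> lies in the same column.\<close>
    define m where "m = (if a < b then 1 else s)"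
    have "t < m" "m \<le> 1" using that z c s t by (auto simp: less_longray_def m_def)
    then obtain q where q: "q \<in> \<rat>" "t < q" "q < m" using Rats_dense_in_real by blast
    have q01: "0 \<le> q" "q < 1" using q t \<open>m \<le> 1\<close> by auto
    have "Abs_longray (a, q) \<in> R" using q q01 by (auto simp: R_def)
    moreover have "Abs_longray (a, q) \<le> z" "c < Abs_longray (a, q)"
      using q q01 z c \<open>a \<le> b\<close>
      by (auto simp: less_eq_longray_def less_longray_def Rep_Abs_longray m_def split: if_splits)
    ultimately show ?thesis by blast
  qed
  define \<V> where "\<V> = insert UNIV (greaterThan ` {r \<in> R. r < c} \<union> lessThan ` {r \<in> R. c < r})"
  have "countable \<V>" using \<open>countable R\<close> by (auto simp: \<V>_def)
  moreover have "\<forall>V\<in>\<V>. open V \<and> c \<in> V" by (auto simp: \<V>_def)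
  moreover have "z = c" if "z \<in> \<Inter>\<V>" for z
  proof (rule ccontr)
    assume "z \<noteq> c"
    then consider "z < c" | "c < z" by fastforce
    then show False
    proof cases
      case 1
      then obtain r where "r \<in> R" "z \<le> r" "r < c" using lo by blast
      then have "{r<..} \<in> \<V>" by (auto simp: \<V>_def)
      then show False using that \<open>z \<le> r\<close> by fastforce
    next
      case 2
      then obtain r where "r \<in> R" "r \<le> z" "c < r" using hi by blast
      then have "{..<r} \<in> \<V>" by (auto simp: \<V>_def)
      then show False using that \<open>r \<le> z\<close> by fastforce
    qed
  qed
  ultimately show ?thesis by (intro exI[of _ \<V>]) auto
qed

text \<open>Countably many open sets intersect in \<open>{c}\<close>; each contains the values of
  \<open>g\<close> from some index on, and countably many indices are bounded in
  \<open>omega1\<close>.\<close>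

lemma eventually_eq_longray_limit:
  fixes g :: "omega1 \<Rightarrow> longray"
  assumes "(g \<longlongrightarrow> c) at_top"
  shows "eventually (\<lambda>x. g x = c) at_top"
proof -
  obtain \<V> where \<V>: "countable \<V>" "\<And>V. V \<in> \<V> \<Longrightarrow> open V \<and> c \<in> V" "\<Inter>\<V> = {c}"
    using longray_point_countable_pseudocharacter by metis
  have "\<exists>h. \<forall>x\<ge>h. g x \<in> V" if "V \<in> \<V>" for V
    using topological_tendstoD[OF assms] \<V>(2)[OF that] by (simp add: eventually_at_top_linorder)
  then obtain h where h: "\<And>V x. V \<in> \<V> \<Longrightarrow> h V \<le> x \<Longrightarrow> g x \<in> V" by metis
  obtain b where b: "\<And>V. V \<in> \<V> \<Longrightarrow> h V < b"
    using countable_bounded_omega1[of "h ` \<V>"] \<V>(1) by auto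
  have "g x = c" if "b \<le> x" for x
  proof -
    have "h V \<le> x" if "V \<in> \<V>" for V
      using b[OF that] \<open>b \<le> x\<close> by simp
    then have "g x \<in> \<Inter>\<V>" using h by blast
    then show ?thesis using \<V>(3) by simp
  qed
  then show ?thesis by (auto simp: eventually_at_top_linorder)
qed

text \<open>The longray has no greatest element, so bounded initial rays cover the compact image and
  finitely many suffice.\<close>

lemma compactin_image_longray_bounded:
  fixes f :: "'a \<Rightarrow> longray"
  assumes "compactin Y K" "continuous_map Y euclidean f"
  shows "\<exists>b. f ` K \<subseteq> {..<b}"
proof -
  have "compact (f ` K)"
    using image_compactin[OF assms] by (simp add: compactin_euclidean_iff)
  moreover obtain g where g: "\<And>b :: longray. b < g b"
    using ex_greater_longray by metis
  then have "f ` K \<subseteq> (\<Union>b\<in>f ` K. {..<g b})"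
    by blast
  ultimately obtain F where F: "F \<subseteq> f ` K" "finite F" "f ` K \<subseteq> (\<Union>b\<in>F. {..<g b})"
    by (meson compactE_image open_lessThan)
  have "z < Max (g ` F)" if z: "z \<in> f ` K" for z
  proof -
    from z F(3) obtain b where b: "b \<in> F" "z < g b" by blast
    have "g b \<le> Max (g ` F)" using F(2) b(1) by simp
    with b(2) show ?thesis by (rule less_le_trans)
  qed
  then have "f ` K \<subseteq> {..<Max (g ` F)}" by blast
  then show ?thesis ..
qed

section \<open>Well-founded meet-semilattices with clopen principal ideals\<close>

text \<open>Meets make the intersection of two principal ideals principal again, and
  well-foundedness supplies the induction behind compactness.\<close>

locale wf_semilattice =
  fixes A :: "'p set" and le :: "'p \<Rightarrow> 'p \<Rightarrow> bool"
  assumes le_refl: "p \<in> A \<Longrightarrow> le p p"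
    and le_trans: "p \<in> A \<Longrightarrow> q \<in> A \<Longrightarrow> r \<in> A \<Longrightarrow> le p q \<Longrightarrow> le q r \<Longrightarrow> le p r"
    and le_antisym: "p \<in> A \<Longrightarrow> q \<in> A \<Longrightarrow> le p q \<Longrightarrow> le q p \<Longrightarrow> p = q"
    and wf_less: "wf {(p, q). p \<in> A \<and> q \<in> A \<and> le p q \<and> p \<noteq> q}"
    and ex_meet: "p \<in> A \<Longrightarrow> q \<in> A \<Longrightarrow> \<exists>r\<in>A. \<forall>s\<in>A. le s r \<longleftrightarrow> le s p \<and> le s q"
begin

definition down :: "'p \<Rightarrow> 'p set"
  where "down p = {s \<in> A. le s p}"

definition ideal_topology :: "'p topology"
  where "ideal_topology = topology_generated_by (down ` A \<union> (\<lambda>p. A - down p) ` A)"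

lemma down_self [simp]: "p \<in> A \<Longrightarrow> p \<in> down p"
  by (simp add: down_def le_refl)

lemma down_mono: "p \<in> A \<Longrightarrow> q \<in> down p \<Longrightarrow> down q \<subseteq> down p"
  by (auto simp: down_def intro: le_trans)

lemma topspace_ideal [simp]: "topspace ideal_topology = A"
proof -
  have "p \<in> \<Union> (down ` A)" if "p \<in> A" for p
    using down_self[OF that] that by blast
  then show ?thesis by (auto simp: ideal_topology_def down_def)
qed

lemma openin_down: "p \<in> A \<Longrightarrow> openin ideal_topology (down p)"
  by (simp add: ideal_topology_def topology_generated_by_Basis)

lemma closedin_down: "p \<in> A \<Longrightarrow> closedin ideal_topology (down p)"
  unfolding closedin_def topspace_ideal
  by (auto simp: down_def)
    (auto simp: ideal_topology_def down_def[symmetric] intro!: topology_generated_by_Basis)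

text \<open>A subbasic ideal containing \<open>p\<close> contains \<open>down p\<close> by
  transitivity, so only the finitely many excluded ideals have to be recorded in
  \<open>Q\<close>.\<close>

lemma ideal_basis:
  assumes "openin ideal_topology W" "p \<in> W"
  obtains Q where "finite Q" "Q \<subseteq> A" "\<And>q. q \<in> Q \<Longrightarrow> p \<notin> down q" "down p - \<Union>(down ` Q) \<subseteq> W"
proof -
  have W: "generate_topology_on (down ` A \<union> (\<lambda>p. A - down p) ` A) W"
    using assms(1) by (simp add: ideal_topology_def openin_topology_generated_by_iff)
  have "p \<in> W \<Longrightarrow> \<exists>Q. finite Q \<and> Q \<subseteq> A \<and> (\<forall>q\<in>Q. p \<notin> down q) \<and> down p - \<Union>(down ` Q) \<subseteq> W"
    using W
  proof induction
    case (Int U V)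
    then obtain Q R where "finite Q" "Q \<subseteq> A" "\<forall>q\<in>Q. p \<notin> down q" "down p - \<Union>(down ` Q) \<subseteq> U"
      "finite R" "R \<subseteq> A" "\<forall>q\<in>R. p \<notin> down q" "down p - \<Union>(down ` R) \<subseteq> V" by auto
    then show ?case by (intro exI[of _ "Q \<union> R"]) auto
  next
    case (UN K)
    then obtain k where "k \<in> K" "p \<in> k" by blast
    with UN.IH show ?case by (meson Union_upper order_trans)
  next
    case (Basis s)
    then consider q where "q \<in> A" "s = down q" | q where "q \<in> A" "s = A - down q" by blast
    then show ?case
    proof cases
      case 1
      with Basis down_mono show ?thesis by (intro exI[of _ "{}"]) auto
    next
      case 2
      with Basis show ?thesis by (intro exI[of _ "{q}"]) (auto simp: down_def)
    qed
  qed simp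
  then show ?thesis using assms(2) that by blast
qed

text \<open>Induction along the order. A cover member around \<open>p\<close> leaves uncovered at
  most finitely many pieces \<open>down p \<inter> down q\<close> with
  \<open>p \<notin> down q\<close>; each is the ideal of a meet strictly below
  \<open>p\<close>.\<close>

lemma compactin_down:
  assumes "p \<in> A"
  shows "compactin ideal_topology (down p)"
  using assms
proof (induction p rule: wf_induct_rule[OF wf_less])
  case (1 p)
  have "\<exists>\<F>. finite \<F> \<and> \<F> \<subseteq> \<U> \<and> down p \<subseteq> \<Union>\<F>"
    if \<U>: "\<forall>U\<in>\<U>. openin ideal_topology U" "down p \<subseteq> \<Union>\<U>" for \<U>
  proof -
    obtain W where W: "W \<in> \<U>" "p \<in> W" using \<U> \<open>p \<in> A\<close> down_self by blast
    then obtain Q where Q: "finite Q" "Q \<subseteq> A" "\<And>q. q \<in> Q \<Longrightarrow> p \<notin> down q" "down p - \<Union>(down ` Q) \<subseteq> W"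
      using \<U> by (meson ideal_basis)
    have "\<exists>\<F>. finite \<F> \<and> \<F> \<subseteq> \<U> \<and> down p \<inter> down q \<subseteq> \<Union>\<F>" if "q \<in> Q" for q
    proof -
      have "q \<in> A" using Q that by blast
      then obtain r where r: "r \<in> A" "\<forall>s\<in>A. le s r \<longleftrightarrow> le s p \<and> le s q"
        using ex_meet \<open>p \<in> A\<close> by blast
      then have dr: "down r = down p \<inter> down q" by (auto simp: down_def)
      have "le r p" using r le_refl by blast
      moreover have "r \<noteq> p"
      proof
        assume "r = p"
        then have "p \<in> down q" using dr down_self[OF \<open>p \<in> A\<close>] by blast
        then show False using Q(3)[OF that] by blast
      qed
      ultimately have "compactin ideal_topology (down r)" using 1 r(1) by blast
      moreover have "down r \<subseteq> \<Union>\<U>" using dr \<U> by blast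
      ultimately show ?thesis using \<U>(1) unfolding dr compactin_def by blast
    qed
    then obtain \<F> where \<F>: "\<And>q. q \<in> Q \<Longrightarrow> finite (\<F> q) \<and> \<F> q \<subseteq> \<U> \<and> down p \<inter> down q \<subseteq> \<Union>(\<F> q)"
      by metis
    show ?thesis
    proof (intro exI conjI)
      show "finite (insert W (\<Union>q\<in>Q. \<F> q))" using Q \<F> by auto
      show "insert W (\<Union>q\<in>Q. \<F> q) \<subseteq> \<U>" using W \<F> by auto
      show "down p \<subseteq> \<Union>(insert W (\<Union>q\<in>Q. \<F> q))"
      proof
        fix s assume s: "s \<in> down p"
        show "s \<in> \<Union>(insert W (\<Union>q\<in>Q. \<F> q))"
        proof (cases "\<exists>q\<in>Q. s \<in> down q")
          case True
          then obtain q where "q \<in> Q" "s \<in> down p \<inter> down q" using s by blast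
          then show ?thesis using \<F>[of q] by blast
        next
          case False
          then have "s \<in> W" using s Q(4) by blast
          then show ?thesis by simp
        qed
      qed
    qed
  qed
  moreover have "down p \<subseteq> A" by (auto simp: down_def)
  ultimately show ?case by (auto simp: compactin_def)
qed

text \<open>By antisymmetry, one of two distinct points lies outside the clopen ideal of the
  other.\<close>

lemma Hausdorff_ideal: "Hausdorff_space ideal_topology"
  unfolding Hausdorff_space_def topspace_ideal
proof (intro allI impI)
  fix p q assume "p \<in> A \<and> q \<in> A \<and> p \<noteq> q"
  then have pq: "p \<in> A" "q \<in> A" "p \<noteq> q" by auto
  have op: "openin ideal_topology (A - down r)" if "r \<in> A" for r
    using closedin_down[OF that] by (simp add: closedin_def)
  show "\<exists>U V. openin ideal_topology U \<and> openin ideal_topology V \<and> p \<in> U \<and> q \<in> V \<and> disjnt U V"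
  proof (cases "p \<in> down q")
    case True
    then have "q \<notin> down p" using pq le_antisym by (auto simp: down_def)
    then show ?thesis
      using pq op openin_down
      by (intro exI[of _ "down p"] exI[of _ "A - down p"]) (auto simp: disjnt_def)
  next
    case False
    then show ?thesis
      using pq op openin_down
      by (intro exI[of _ "A - down q"] exI[of _ "down q"]) (auto simp: disjnt_def)
  qed
qed

lemma locally_compact_ideal: "locally_compact_space ideal_topology"
  unfolding locally_compact_space_def topspace_ideal
  using compactin_down openin_down down_self by blast

lemma tychonoff_ideal: "tychonoff_space ideal_topology"
  using Hausdorff_ideal locally_compact_ideal locally_compact_Hausdorff_imp_regular_space
    completely_regular_eq_regular_space unfolding tychonoff_space_def by blast

text \<open>By \<open>ideal_basis\<close> a neighbourhood imposes only finitely many of these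
  eventual conditions, and those hold together eventually.\<close>

lemma limitin_ideal:
  assumes "p \<in> A" "eventually (\<lambda>i. g i \<in> down p) F"
    and "\<And>q. q \<in> A \<Longrightarrow> p \<notin> down q \<Longrightarrow> eventually (\<lambda>i. g i \<notin> down q) F"
  shows "limitin ideal_topology g p F"
  unfolding limitin_def topspace_ideal
proof (intro conjI allI impI)
  fix W assume "openin ideal_topology W \<and> p \<in> W"
  then obtain Q where Q: "finite Q" "Q \<subseteq> A" "\<And>q. q \<in> Q \<Longrightarrow> p \<notin> down q" "down p - \<Union>(down ` Q) \<subseteq> W"
    using ideal_basis by metis
  have "eventually (\<lambda>i. \<forall>q\<in>Q. g i \<notin> down q) F"
    using Q assms(3) by (intro eventually_ball_finite) auto
  with assms(2) show "eventually (\<lambda>i. g i \<in> W) F"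
    by eventually_elim (use Q(4) in blast)
qed (fact assms)

end

section \<open>The plank\<close>

text \<open>Row \<open>y\<close> (third coordinate \<open>y\<close>) in the lexicographic order is a concatenation of copies of \<open>[y, \<omega>\<^sub>1)\<close>,
  one for each \<open>a < y\<close>, closed off by the point \<open>(y, y, y)\<close>; so it is a well-order of type \<open>\<omega>\<^sub>1 \<cdot> y + 1\<close>.
  The edges \<open>E\<^sub>a = {(a, y, y) | a \<le> y}\<close> separate consecutive copies.\<close>

definition plank :: "(omega1 \<times> omega1 \<times> omega1) set"
  where "plank = {(a, x, y). a \<le> y \<and> y \<le> x \<and> (a = y \<longrightarrow> x = y)}"

definition tle :: "omega1 \<times> omega1 \<times> omega1 \<Rightarrow> omega1 \<times> omega1 \<times> omega1 \<Rightarrow> bool"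
  where "tle = (\<lambda>(a, x, y) (b, z, w). y \<le> w \<and> (a < b \<or> a = b \<and> x \<le> z))"

lemma plank_iff: "(a, x, y) \<in> plank \<longleftrightarrow> a \<le> y \<and> y \<le> x \<and> (a = y \<longrightarrow> x = y)"
  by (simp add: plank_def)

lemma tle_iff: "tle (a, x, y) (b, z, w) \<longleftrightarrow> y \<le> w \<and> (a < b \<or> a = b \<and> x \<le> z)"
  by (simp add: tle_def)

text \<open>In the plank \<open>a \<le> y\<close>; if also \<open>y \<le> w\<close>, then
  \<open>a = w\<close> forces \<open>y = w\<close> and so \<open>x = w\<close>. Thus
  \<open>(w, w, w)\<close> dominates every row up to \<open>w\<close>.\<close>

lemma tle_top: "(a, x, y) \<in> plank \<Longrightarrow> tle (a, x, y) (w, w, w) \<longleftrightarrow> y \<le> w"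
  by (auto simp: plank_iff tle_iff)

text \<open>The natural candidate is the lexicographic minimum \<open>(b, z)\<close> of the first
  two coordinates, placed in the smaller row \<open>w\<close>.\<close>

lemma tle_meet:
  assumes "p \<in> plank" "q \<in> plank"
  shows "\<exists>r\<in>plank. \<forall>s\<in>plank. tle s r \<longleftrightarrow> tle s p \<and> tle s q"
proof -
  obtain a x y a' x' y' where pq: "p = (a, x, y)" "q = (a', x', y')" by (metis prod_cases3)
  define w where "w = min y y'"
  obtain b z where bz: "\<And>c u. (c < b \<or> c = b \<and> u \<le> z) \<longleftrightarrow>
      (c < a \<or> c = a \<and> u \<le> x) \<and> (c < a' \<or> c = a' \<and> u \<le> x')" "w \<le> z"
  proof (cases "a < a' \<or> a = a' \<and> x \<le> x'")
    case True
    then show ?thesis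
      using assms by (intro that[of a x]) (auto simp: pq w_def plank_iff min_le_iff_disj)
  next
    case False
    then show ?thesis
      using assms by (intro that[of a' x']) (auto simp: pq w_def plank_iff min_le_iff_disj)
  qed
  have meet: "tle (c, u, v) p \<and> tle (c, u, v) q \<longleftrightarrow> v \<le> w \<and> (c < b \<or> c = b \<and> u \<le> z)" for c u v
    by (auto simp: pq tle_iff bz(1) w_def)
  show ?thesis
  proof (cases "b < w")
    case True
    then have "(b, z, w) \<in> plank" using bz(2) by (auto simp: plank_iff)
    moreover have "tle s (b, z, w) \<longleftrightarrow> tle s p \<and> tle s q" for s
      by (cases s) (simp only: meet tle_iff)
    ultimately show ?thesis by blast
  next
    \<comment> \<open>For \<open>b \<ge> w\<close> the candidate may leave the plank. But then all
      plank points in rows up to \<open>w\<close> satisfy the lexicographic condition, so the top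
      point of row \<open>w\<close> is the meet.\<close>
    case False
    have "(w, w, w) \<in> plank" by (simp add: plank_iff)
    moreover have "tle s (w, w, w) \<longleftrightarrow> tle s p \<and> tle s q" if "s \<in> plank" for s
    proof -
      obtain c u v where s: "s = (c, u, v)" by (metis prod_cases3)
      have "c < b \<or> c = b \<and> u \<le> z" if "v \<le> w"
        using \<open>s \<in> plank\<close> that False bz(2) by (auto simp: s plank_iff)
      then show ?thesis using \<open>s \<in> plank\<close> by (auto simp: s meet tle_top)
    qed
    ultimately show ?thesis by blast
  qed
qed

text \<open>A strict step down lowers \<open>(y, a, x)\<close>, with the row first, in the
  lexicographic order.\<close>

lemma wf_tle: "wf {(p, q). tle p q \<and> p \<noteq> q}"
proof (rule wf_subset)
  let ?L = "{(x, y :: omega1). x < y}"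
  show "wf (inv_image (?L <*lex*> ?L <*lex*> ?L) (\<lambda>(a, x, y). (y, a, x)))"
    by (intro wf_inv_image wf_lex_prod wf)
qed (auto simp: tle_iff inv_image_def)

text \<open>The injection carries the plank to another type, as the theorem requires; the order is
  read back through \<open>inv j\<close>.\<close>

locale plank_copy =
  fixes j :: "omega1 \<times> omega1 \<times> omega1 \<Rightarrow> 'p"
  assumes inj: "inj j"
begin

lemma inv_j [simp]: "inv j (j p) = p"
  by (rule inv_f_f[OF inj])

lemma j_mem_image [simp]: "j p \<in> j ` T \<longleftrightarrow> p \<in> T"
  using inj by (auto dest: injD)

sublocale wf_semilattice "j ` plank" "\<lambda>u v. tle (inv j u) (inv j v)"
proof
  show "wf {(u, v). u \<in> j ` plank \<and> v \<in> j ` plank \<and> tle (inv j u) (inv j v) \<and> u \<noteq> v}"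
    by (rule wf_subset[OF wf_inv_image[OF wf_tle, of "inv j"]]) (auto simp: inv_image_def)
  show "\<exists>r\<in>j ` plank. \<forall>s\<in>j ` plank.
      tle (inv j s) (inv j r) \<longleftrightarrow> tle (inv j s) (inv j p) \<and> tle (inv j s) (inv j q)"
    if "p \<in> j ` plank" "q \<in> j ` plank" for p q
    using tle_meet that by auto
qed (auto simp: tle_iff)

section \<open>Compact open unions of rows and countable compactness\<close>

abbreviation Y :: "'p topology"
  where "Y \<equiv> ideal_topology"

text \<open>By \<open>j_mem_rows\<close> this collects all rows up to \<open>y\<close>, not row
  \<open>y\<close> alone.\<close>

definition rows :: "omega1 \<Rightarrow> 'p set"
  where "rows y = down (j (y, y, y))"

lemma j_mem_down: "j s \<in> down (j p) \<longleftrightarrow> s \<in> plank \<and> tle s p"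
  by (simp add: down_def)

lemma mem_plankE:
  assumes "u \<in> j ` plank"
  obtains a x y where "u = j (a, x, y)" "(a, x, y) \<in> plank"
  using assms by auto

lemma j_mem_rows: "j (a, x, y) \<in> rows w \<longleftrightarrow> (a, x, y) \<in> plank \<and> y \<le> w"
  by (auto simp: rows_def j_mem_down tle_top)

lemma rows_subset: "rows w \<subseteq> j ` plank"
  by (auto simp: rows_def down_def)

lemma rows_mono: "v \<le> w \<Longrightarrow> rows v \<subseteq> rows w"
  using rows_subset[of v] by (auto simp: j_mem_rows)

lemma ex_rows: "u \<in> j ` plank \<Longrightarrow> \<exists>w. u \<in> rows w"
  by (auto simp: j_mem_rows)

lemma diag_mem: "(y, y, y) \<in> plank"
  by (simp add: plank_iff)

lemma openin_rows: "openin Y (rows y)"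
  unfolding rows_def by (rule openin_down) (simp add: diag_mem)

lemma closedin_rows: "closedin Y (rows y)"
  unfolding rows_def by (rule closedin_down) (simp add: diag_mem)

lemma compactin_rows: "compactin Y (rows y)"
  unfolding rows_def by (rule compactin_down) (simp add: diag_mem)

lemma Lindelof_if_subset_rows:
  assumes "closedin Y T" "T \<subseteq> rows y"
  shows "Lindelof_space (subtopology Y T)"
  using closed_compactin[OF compactin_rows assms(2,1)]
  by (simp add: compact_space_subtopology compact_imp_Lindelof_space)

lemma Type_I_plank: "Type_I Y"
  unfolding Type_I_def
proof (intro exI conjI allI)
  have cl: "Y closure_of rows a = rows a" for a
    by (simp add: closedin_rows closure_of_closedin)
  show "systematic_cover Y rows"
    unfolding systematic_cover_def topspace_ideal cl
  proof (intro conjI allI impI)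
    show "(\<Union>a. rows a) = j ` plank" using rows_subset ex_rows by blast
    show "rows a \<subseteq> rows b" if "a < b" for a b using that by (intro rows_mono) simp
  qed (rule openin_rows)
  show "Lindelof_space (subtopology Y (Y closure_of rows a))" for a
    unfolding cl by (rule Lindelof_if_subset_rows[OF closedin_rows order_refl])
qed

text \<open>Each \<open>rows y\<close> needs finitely many cover members. A countable cover has only
  countably many finite subfamilies, so a single one serves cofinally many \<open>y\<close>, hence
  the whole space.\<close>

lemma countably_compact_plank: "countably_compact_space Y"
  unfolding countably_compact_space_def
proof (intro allI impI)
  fix \<U> assume \<U>: "countable \<U> \<and> (\<forall>U\<in>\<U>. openin Y U) \<and> \<Union>\<U> = topspace Y"
  have "\<exists>F. finite F \<and> F \<subseteq> \<U> \<and> rows y \<subseteq> \<Union>F" for y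
  proof -
    have "rows y \<subseteq> \<Union>\<U>" using \<U> rows_subset by simp
    moreover have "openin Y U" if "U \<in> \<U>" for U using \<U> that by blast
    ultimately show ?thesis using compactinD[OF compactin_rows, of \<U> y] by blast
  qed
  then obtain F where F: "\<And>y. finite (F y)" "\<And>y. F y \<subseteq> \<U>" "\<And>y. rows y \<subseteq> \<Union>(F y)"
    by metis
  have "range F \<subseteq> {T. finite T \<and> T \<subseteq> \<U>}" using F by blast
  then have cr: "countable (range F)"
    using countable_Collect_finite_subset[of \<U>] \<U> by (meson countable_subset)
  have "\<exists>T\<in>range F. \<forall>b. \<exists>y>b. F y = T"
  proof (rule ccontr)
    assume "\<not> ?thesis"
    then have "\<forall>T\<in>range F. \<exists>b. \<forall>y. b < y \<longrightarrow> F y \<noteq> T" by auto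
    then obtain b where b: "\<And>T y. T \<in> range F \<Longrightarrow> b T < y \<Longrightarrow> F y \<noteq> T" by metis
    \<comment> \<open>Above all the bounds no subfamily can be used, yet \<open>F c\<close> is used
      at \<open>c\<close>.\<close>
    obtain c where "\<forall>d\<in>b ` range F. d < c"
      using countable_bounded_omega1[of "b ` range F"] cr by blast
    then have "b (F c) < c" by blast
    then show False using b[of "F c" c] by blast
  qed
  then obtain T where T: "T \<in> range F" "\<And>b. \<exists>y>b. F y = T" by blast
  have "topspace Y \<subseteq> \<Union>T"
  proof
    fix u assume "u \<in> topspace Y"
    then obtain w where "u \<in> rows w" using ex_rows by auto
    moreover obtain y where "w < y" "F y = T" using T(2) by blast
    ultimately show "u \<in> \<Union>T" using F(3)[of y] rows_mono[OF less_imp_le] by blast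
  qed
  moreover have "finite T" "T \<subseteq> \<U>" using T(1) F(1,2) by auto
  moreover have "\<Union>T \<subseteq> topspace Y" using \<open>T \<subseteq> \<U>\<close> \<U> by blast
  ultimately show "\<exists>\<V>. finite \<V> \<and> \<V> \<subseteq> \<U> \<and> \<Union>\<V> = topspace Y" by blast
qed

text \<open>Countably many of the increasing open sets \<open>rows\<close> cover \<open>T\<close>,
  and their indices are bounded. With \<open>Lindelof_if_subset_rows\<close>, a closed set is
  Lindelof exactly when some \<open>rows y\<close> contains it.\<close>

lemma Lindelof_imp_subset_rows:
  assumes "Lindelof_space (subtopology Y T)" "T \<subseteq> topspace Y"
  shows "\<exists>y. T \<subseteq> rows y"
proof -
  have "T \<subseteq> \<Union>(range rows)" using assms(2) ex_rows by auto
  moreover have "\<forall>U\<in>range rows. openin Y U" using openin_rows by blast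
  ultimately obtain V where V: "countable V" "V \<subseteq> range rows" "T \<subseteq> \<Union>V"
    using assms(1) unfolding Lindelof_space_subtopology_subset[OF assms(2)] by metis
  then obtain B where B: "countable B" "V = rows ` B"
    by (meson countable_subset_image)
  then obtain b where "\<forall>a\<in>B. a < b" using countable_bounded_omega1 by blast
  then have "T \<subseteq> rows b"
    using V(3) B(2) rows_mono less_imp_le by (auto dest!: subsetD) blast
  then show ?thesis ..
qed

section \<open>A systematic cover refuting narrowness\<close>

definition origin :: omega1
  where "origin = (LEAST a. True)"

lemma origin_le: "origin \<le> a"
  unfolding origin_def by (rule Least_le) simp

definition before :: "omega1 \<Rightarrow> 'p set"
  where "before g = j ` {(a, x, y) \<in> plank. a < g}"

text \<open>\<open>before g\<close> with the edge \<open>E_g\<close> added: a closed set that still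
  lies in \<open>before b\<close> for every \<open>b > g\<close>.\<close>

definition before_closure :: "omega1 \<Rightarrow> 'p set"
  where "before_closure g = j ` {(a, x, y) \<in> plank. a < g \<or> a = g \<and> x = y}"

text \<open>The set is downward closed, hence a union of open principal ideals.\<close>

lemma openin_before: "openin Y (before g)"
proof (subst openin_subopen, intro ballI)
  fix u assume "u \<in> before g"
  then obtain a x y where u: "u = j (a, x, y)" "(a, x, y) \<in> plank" "a < g"
    by (auto simp: before_def)
  have "down u \<subseteq> before g"
  proof
    fix s assume s: "s \<in> down u"
    then have "s \<in> j ` plank" by (simp add: down_def)
    then obtain b z w where "s = j (b, z, w)" "(b, z, w) \<in> plank" by (rule mem_plankE)
    with s u show "s \<in> before g" by (auto simp: before_def j_mem_down tle_iff)
  qed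
  then show "\<exists>T. openin Y T \<and> u \<in> T \<and> T \<subseteq> before g"
    using u openin_down[of u] down_self[of u] by (intro exI[of _ "down u"]) auto
qed

text \<open>A point of row \<open>y\<close> beyond \<open>E_g\<close> is separated from the set by
  removing \<open>down (j (g, y, y))\<close> from its ideal: what remains lies in rows up to
  \<open>y\<close> and lexicographically beyond \<open>(g, y)\<close>.\<close>

lemma closedin_before_closure: "closedin Y (before_closure g)"
  unfolding closedin_def
proof
  show "before_closure g \<subseteq> topspace Y" by (auto simp: before_closure_def)
  show "openin Y (topspace Y - before_closure g)"
  proof (subst openin_subopen, intro ballI)
    fix u assume u: "u \<in> topspace Y - before_closure g"
    then have "u \<in> j ` plank" by simp
    then obtain a x y where p: "u = j (a, x, y)" "(a, x, y) \<in> plank" by (rule mem_plankE)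
    have ax: "g < a \<or> g = a \<and> y < x"
      using u p by (auto simp: before_closure_def plank_iff)
    then have "g < y" using p(2) by (auto simp: plank_iff)
    then have m: "(g, y, y) \<in> plank" by (simp add: plank_iff)
    have "down u - down (j (g, y, y)) \<subseteq> topspace Y - before_closure g"
    proof
      fix s assume s: "s \<in> down u - down (j (g, y, y))"
      then have "s \<in> j ` plank" by (simp add: down_def)
      then obtain b z w where q: "s = j (b, z, w)" "(b, z, w) \<in> plank" by (rule mem_plankE)
      with s p have "w \<le> y" "g < b \<or> g = b \<and> y < z" by (auto simp: j_mem_down tle_iff)
      then show "s \<in> topspace Y - before_closure g"
        using q by (auto simp: before_closure_def)
    qed
    moreover have "openin Y (down u - down (j (g, y, y)))"
      using p m by (intro openin_diff openin_down closedin_down) auto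
    moreover have "u \<in> down u - down (j (g, y, y))"
      using p ax by (auto simp: j_mem_down tle_iff)
    ultimately show "\<exists>T. openin Y T \<and> u \<in> T \<and> T \<subseteq> topspace Y - before_closure g" by blast
  qed
qed

lemma not_narrow_plank: "\<not> narrow_in_itself Y"
proof
  assume n: "narrow_in_itself Y"
  have "systematic_cover Y before"
    unfolding systematic_cover_def
  proof (intro conjI allI impI)
    show "openin Y (before a)" for a by (rule openin_before)
    have "j (a, x, y) \<in> before (succ a)" if "(a, x, y) \<in> plank" for a x y
      using that by (simp add: before_def)
    then show "(\<Union>a. before a) = topspace Y"
      using ex_greater_omega1 by (auto simp: before_def)
    fix a b :: omega1 assume "a < b"
    have "Y closure_of before a \<subseteq> before_closure a"
      by (rule closure_of_minimal[OF _ closedin_before_closure])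
        (auto simp: before_def before_closure_def)
    also have "before_closure a \<subseteq> before b"
      using \<open>a < b\<close> by (auto simp: before_def before_closure_def)
    finally show "Y closure_of before a \<subseteq> before b" .
  qed
  moreover have "topspace Y \<noteq> before a" for a
  proof -
    have "j (a, a, a) \<in> topspace Y" "j (a, a, a) \<notin> before a"
      by (auto simp: diag_mem before_def)
    then show ?thesis by blast
  qed
  \<comment> \<open>\<open>before origin\<close> is empty; \<open>before (succ origin)\<close>
    already meets every row, at \<open>(origin, w, w)\<close>.\<close>
  ultimately have "Lindelof_space (subtopology Y (Y closure_of before (succ origin)))"
    using n unfolding narrow_in_itself_def by blast
  then obtain y where y: "Y closure_of before (succ origin) \<subseteq> rows y"
    using Lindelof_imp_subset_rows closure_of_subset_topspace by metis
  obtain w where "y < w" using ex_greater_omega1 by blast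
  have "j (origin, w, w) \<in> before (succ origin)"
    using origin_le by (simp add: before_def plank_iff)
  moreover have "before (succ origin) \<subseteq> Y closure_of before (succ origin)"
    by (rule closure_of_subset) (auto simp: before_def)
  ultimately have "j (origin, w, w) \<in> rows y" using y by blast
  then have "w \<le> y" by (simp add: j_mem_rows)
  then show False using \<open>y < w\<close> by simp
qed

section \<open>Limits along rows, columns and edges\<close>

lemma tendsto_plank:
  fixes f :: "'p \<Rightarrow> longray"
  assumes f: "continuous_map Y euclidean f" and p: "p \<in> plank"
    and "eventually (\<lambda>i. g i \<in> plank \<and> tle (g i) p) F"
    and "\<And>q. q \<in> plank \<Longrightarrow> \<not> tle p q \<Longrightarrow> eventually (\<lambda>i. \<not> tle (g i) q) F"
  shows "((\<lambda>i. f (j (g i))) \<longlongrightarrow> f (j p)) F"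
proof -
  have "limitin Y (\<lambda>i. j (g i)) (j p) F"
  proof (rule limitin_ideal)
    show "j p \<in> j ` plank" using p by simp
    show "eventually (\<lambda>i. j (g i) \<in> down (j p)) F"
      using assms(3) by (simp add: j_mem_down)
    fix q assume "q \<in> j ` plank" "j p \<notin> down q"
    then obtain q' where "q = j q'" "q' \<in> plank" "\<not> tle p q'"
      using p by (auto simp: j_mem_down)
    then show "eventually (\<lambda>i. j (g i) \<notin> down q) F"
      using assms(4)[of q'] by (auto simp: j_mem_down elim: eventually_mono)
  qed
  from continuous_map_limit[OF f this] show ?thesis by (simp add: o_def)
qed

text \<open>Within row \<open>y\<close>, the edge point \<open>(succ a, y, y)\<close> is the least
  upper bound of block \<open>a\<close>.\<close>

lemma tendsto_block_end:
  fixes f :: "'p \<Rightarrow> longray"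
  assumes f: "continuous_map Y euclidean f" and "a < y"
  shows "((\<lambda>x. f (j (a, x, y))) \<longlongrightarrow> f (j (succ a, y, y))) at_top"
proof (rule tendsto_plank[OF f])
  show "(succ a, y, y) \<in> plank" using \<open>a < y\<close> by (simp add: plank_iff succ_le_iff)
  show "eventually (\<lambda>x. (a, x, y) \<in> plank \<and> tle (a, x, y) (succ a, y, y)) at_top"
    using eventually_ge_at_top[of y]
    by eventually_elim (use \<open>a < y\<close> in \<open>auto simp: plank_iff tle_iff\<close>)
  fix q assume "q \<in> plank" "\<not> tle (succ a, y, y) q"
  then obtain c z w where q: "q = (c, z, w)" "c \<le> w" "w \<le> z"
    "\<not> (y \<le> w \<and> (succ a < c \<or> succ a = c \<and> y \<le> z))"
    by (cases q) (auto simp: plank_iff tle_iff)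
  show "eventually (\<lambda>x. \<not> tle (a, x, y) q) at_top"
    using eventually_gt_at_top[of z]
  proof eventually_elim
    case (elim x)
    \<comment> \<open>Since \<open>y \<le> w \<le> z\<close>, the case \<open>c = succ a\<close>
      would put \<open>q\<close> above the limit point.\<close>
    have "c \<le> a" if "y \<le> w"
    proof -
      have "\<not> succ a < c" "succ a \<noteq> c" using q that by auto
      then have "c < succ a" by simp
      then show ?thesis by (simp add: less_succ_iff)
    qed
    then show ?case using elim by (auto simp: q tle_iff)
  qed
qed

lemma tendsto_column:
  fixes f :: "'p \<Rightarrow> longray"
  assumes f: "continuous_map Y euclidean f"
    and y: "\<And>n. Z n < y" "\<And>w. w < y \<Longrightarrow> eventually (\<lambda>n. w < Z n) sequentially"
    and "a < y" "y \<le> x"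
  shows "(\<lambda>n. f (j (a, x, Z n))) \<longlonglongrightarrow> f (j (a, x, y))"
proof (rule tendsto_plank[OF f])
  show "(a, x, y) \<in> plank" using assms by (auto simp: plank_iff)
  show "eventually (\<lambda>n. (a, x, Z n) \<in> plank \<and> tle (a, x, Z n) (a, x, y)) sequentially"
    using y(2)[OF \<open>a < y\<close>]
  proof eventually_elim
    case (elim n)
    with y(1)[of n] \<open>y \<le> x\<close> show ?case by (auto simp: plank_iff tle_iff)
  qed
  fix q assume "q \<in> plank" "\<not> tle (a, x, y) q"
  then obtain c z w where q: "q = (c, z, w)" "\<not> (y \<le> w \<and> (a < c \<or> a = c \<and> x \<le> z))"
    by (cases q) (auto simp: tle_iff)
  show "eventually (\<lambda>n. \<not> tle (a, x, Z n) q) sequentially"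
  proof (cases "w < y")
    case True
    from y(2)[OF True] show ?thesis by eventually_elim (auto simp: q tle_iff)
  next
    case False
    then have "\<not> (a < c \<or> a = c \<and> x \<le> z)" using q(2) by simp
    then show ?thesis by (simp add: q(1) tle_iff)
  qed
qed

text \<open>A plank point \<open>q\<close> in a row \<open>w \<ge> y\<close> has
  \<open>z \<ge> y\<close>, so it can fail to bound the limit only through \<open>c < a\<close>, and
  then it bounds no term of the sequence.\<close>

lemma tendsto_edge:
  fixes f :: "'p \<Rightarrow> longray"
  assumes f: "continuous_map Y euclidean f"
    and y: "\<And>n. Z n < y" "\<And>w. w < y \<Longrightarrow> eventually (\<lambda>n. w < Z n) sequentially"
    and "a \<le> y" "eventually (\<lambda>n. a \<le> Z n) sequentially"
  shows "(\<lambda>n. f (j (a, Z n, Z n))) \<longlonglongrightarrow> f (j (a, y, y))"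
proof (rule tendsto_plank[OF f])
  show "(a, y, y) \<in> plank" using assms by (auto simp: plank_iff)
  show "eventually (\<lambda>n. (a, Z n, Z n) \<in> plank \<and> tle (a, Z n, Z n) (a, y, y)) sequentially"
    using assms(5)
  proof eventually_elim
    case (elim n)
    with y(1)[of n] show ?case by (auto simp: plank_iff tle_iff)
  qed
  fix q assume "q \<in> plank" "\<not> tle (a, y, y) q"
  then obtain c z w where q: "q = (c, z, w)" "c \<le> w" "w \<le> z" "\<not> (y \<le> w \<and> (a < c \<or> a = c \<and> y \<le> z))"
    by (cases q) (auto simp: tle_iff plank_iff)
  show "eventually (\<lambda>n. \<not> tle (a, Z n, Z n) q) sequentially"
  proof (cases "w < y")
    case True
    from y(2)[OF True] show ?thesis by eventually_elim (auto simp: q tle_iff)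
  next
    case False
    then have "c < a" using q by auto
    then have "\<not> a < c" "a \<noteq> c" by auto
    then show ?thesis by (simp add: q(1) tle_iff)
  qed
qed

text \<open>At a limit index the edge points of one row converge from the left, so constancy passes
  to the limit.\<close>

lemma edge_limit_const:
  fixes f :: "'p \<Rightarrow> longray"
  assumes f: "continuous_map Y euclidean f" and "a \<le> y"
    and lim: "\<And>b. b < a \<Longrightarrow> \<exists>b'. b < b' \<and> b' < a" and "b0 < a"
    and c: "\<And>b. b < a \<Longrightarrow> f (j (b, y, y)) = c"
  shows "f (j (a, y, y)) = c"
proof -
  \<comment> \<open>\<open>F\<close> is the filter of left neighbourhoods of \<open>a\<close>;
    \<open>lim\<close> makes it proper, so that limits are unique.\<close>
  define F where "F = (INF b\<in>{..<a}. principal {b<..<a})"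
  have ev: "eventually P F \<longleftrightarrow> (\<exists>b\<in>{..<a}. \<forall>b'\<in>{b<..<a}. P b')" for P
    unfolding F_def
  proof (subst eventually_INF_base)
    show "{..<a} \<noteq> {}" using \<open>b0 < a\<close> by blast
    show "\<exists>x\<in>{..<a}. principal {x<..<a} \<le> inf (principal {b<..<a}) (principal {b'<..<a})"
      if "b \<in> {..<a}" "b' \<in> {..<a}" for b b'
      using that by (intro bexI[of _ "max b b'"]) auto
  qed (simp add: eventually_principal)
  have "\<not> eventually (\<lambda>_. False) F"
    unfolding ev using lim by (metis greaterThanLessThan_iff lessThan_iff)
  then have nb: "F \<noteq> bot" by (auto simp: trivial_limit_def)
  have "((\<lambda>b. f (j (b, y, y))) \<longlongrightarrow> f (j (a, y, y))) F"
  proof (rule tendsto_plank[OF f])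
    show "(a, y, y) \<in> plank" using \<open>a \<le> y\<close> by (simp add: plank_iff)
    show "eventually (\<lambda>b. (b, y, y) \<in> plank \<and> tle (b, y, y) (a, y, y)) F"
      unfolding ev using \<open>b0 < a\<close> \<open>a \<le> y\<close> by (auto simp: plank_iff tle_iff intro!: bexI[of _ b0])
    fix q assume "q \<in> plank" "\<not> tle (a, y, y) q"
    then obtain d z w where q: "q = (d, z, w)" "d \<le> w" "w \<le> z"
      "\<not> (y \<le> w \<and> (a < d \<or> a = d \<and> y \<le> z))"
      by (cases q) (auto simp: tle_iff plank_iff)
    show "eventually (\<lambda>b. \<not> tle (b, y, y) q) F"
    proof (cases "w < y")
      case True
      then show ?thesis using \<open>b0 < a\<close> by (auto simp: ev q tle_iff intro!: bexI[of _ b0])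
    next
      case False
      then have "d < a" using q by auto
      then show ?thesis by (auto simp: ev q tle_iff intro!: bexI[of _ d])
    qed
  qed
  moreover have "((\<lambda>b. f (j (b, y, y))) \<longlongrightarrow> c) F"
    by (rule tendsto_eventually) (use c \<open>b0 < a\<close> in \<open>auto simp: ev\<close>)
  ultimately show ?thesis using tendsto_unique[OF nb] by blast
qed

section \<open>Rows on which a function is constant\<close>

text \<open>On row \<open>Z n\<close> each block has reached its end value by \<open>x = y\<close>.
  Letting \<open>n\<close> grow, columns converge to row \<open>y\<close> and edges to its edge
  points, so on row \<open>y\<close> each block is constant with its end value.\<close>

lemma row_const:
  fixes f :: "'p \<Rightarrow> longray"
  assumes f: "continuous_map Y euclidean f"
    and y: "\<And>n. Z n < y" "\<And>w. w < y \<Longrightarrow> eventually (\<lambda>n. w < Z n) sequentially"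
    and Z: "\<And>n a x. a < Z n \<Longrightarrow> y \<le> x \<Longrightarrow> f (j (a, x, Z n)) = f (j (succ a, Z n, Z n))"
    and p: "(a, x, y) \<in> plank"
  shows "f (j (a, x, y)) = f (j (origin, y, y))"
proof -
  have block: "f (j (a, x, y)) = f (j (succ a, y, y))" if "a < y" "y \<le> x" for a x
  proof -
    have "eventually (\<lambda>n. succ a \<le> Z n) sequentially"
      using y(2)[OF that(1)] by (simp add: succ_le_iff)
    with tendsto_edge[OF f y, of "succ a"] that(1)
    have "(\<lambda>n. f (j (succ a, Z n, Z n))) \<longlonglongrightarrow> f (j (succ a, y, y))"
      by (simp add: succ_le_iff)
    moreover have "eventually (\<lambda>n. f (j (a, x, Z n)) = f (j (succ a, Z n, Z n))) sequentially"
      using y(2)[OF that(1)] by eventually_elim (simp add: Z that(2))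
    ultimately have "(\<lambda>n. f (j (a, x, Z n))) \<longlonglongrightarrow> f (j (succ a, y, y))"
      by (simp add: tendsto_cong)
    with tendsto_column[OF f y that] show ?thesis
      by (rule LIMSEQ_unique)
  qed
  \<comment> \<open>Induction on the edge index: a successor edge is reached across a block,
    starting at \<open>x = y\<close>, and a limit edge by \<open>edge_limit_const\<close>.\<close>
  have edge: "a \<le> y \<Longrightarrow> f (j (a, y, y)) = f (j (origin, y, y))" for a
  proof (induction a rule: less_induct)
    case (less a)
    show ?case
    proof (cases "\<exists>b<a. \<forall>b'>b. a \<le> b'")
      case True
      then obtain b where b: "b < a" "\<forall>b'>b. a \<le> b'" by blast
      then have "a = succ b" using less_succ[of b] succ_le_iff[of b a] by (auto intro: antisym)
      moreover have "f (j (b, y, y)) = f (j (origin, y, y))" using less b(1) by simp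
      moreover have "b < y" using b(1) less.prems by simp
      ultimately show ?thesis using block[of b y] by simp
    next
      case False
      show ?thesis
      proof (cases "a = origin")
        case False': False
        show ?thesis
        proof (rule edge_limit_const[OF f less.prems])
          show "origin < a" using origin_le[of a] False' by simp
          show "\<exists>b'. b < b' \<and> b' < a" if "b < a" for b
            using False that by (meson not_less)
          show "f (j (b, y, y)) = f (j (origin, y, y))" if "b < a" for b
            using less that by simp
        qed
      qed simp
    qed
  qed
  show ?thesis
  proof (cases "a < y")
    case True
    then have "f (j (a, x, y)) = f (j (succ a, y, y))" using p by (simp add: block plank_iff)
    also have "\<dots> = f (j (origin, y, y))" using True by (simp add: edge succ_le_iff)
    finally show ?thesis .
  next
    case False
    with p have "a = y" "x = y" by (auto simp: plank_iff)
    then show ?thesis using edge[of y] by simp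
  qed
qed

text \<open>Closing off: \<open>H y\<close> exceeds the index from which all blocks of row
  \<open>y\<close> are constant, and also some members of \<open>X1\<close> and \<open>X2\<close>
  above \<open>y\<close>. The supremum of the iterates of \<open>H\<close> is the required
  row.\<close>

lemma ex_const_row:
  fixes f :: "'p \<Rightarrow> longray"
  assumes f: "continuous_map Y euclidean f"
    and X: "\<And>b. \<exists>u\<in>X1. b < u" "\<And>b. \<exists>u\<in>X2. b < (u :: omega1)"
  obtains y where "\<And>w. w < y \<Longrightarrow> \<exists>u\<in>X1. w < u \<and> u < y" "\<And>w. w < y \<Longrightarrow> \<exists>u\<in>X2. w < u \<and> u < y"
    "\<And>a x. (a, x, y) \<in> plank \<Longrightarrow> f (j (a, x, y)) = f (j (origin, y, y))" "origin < y"
proof -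
  have "\<exists>h>y. (\<exists>u\<in>X1. y < u \<and> u < h) \<and> (\<exists>u\<in>X2. y < u \<and> u < h) \<and>
      (\<forall>a<y. \<forall>x\<ge>h. f (j (a, x, y)) = f (j (succ a, y, y)))" for y
  proof -
    obtain u1 u2 where u: "u1 \<in> X1" "y < u1" "u2 \<in> X2" "y < u2" using X by meson
    have "\<exists>h. \<forall>x\<ge>h. f (j (a, x, y)) = f (j (succ a, y, y))" if "a < y" for a
      using eventually_eq_longray_limit[OF tendsto_block_end[OF f that]]
      by (simp add: eventually_at_top_linorder)
    then obtain k where k: "\<And>a x. a < y \<Longrightarrow> k a \<le> x \<Longrightarrow> f (j (a, x, y)) = f (j (succ a, y, y))"
      by metis
    \<comment> \<open>Row \<open>y\<close> has only countably many blocks, so one \<open>h\<close>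
      works for all of them.\<close>
    have "countable ({u1, u2} \<union> k ` {..<y})"
      using countable_lessThan_omega1 by simp
    then obtain h where h: "\<forall>b\<in>{u1, u2} \<union> k ` {..<y}. b < h"
      using countable_bounded_omega1 by blast
    then have h': "u1 < h" "u2 < h" "\<And>a. a < y \<Longrightarrow> k a < h" by auto
    have "f (j (a, x, y)) = f (j (succ a, y, y))" if "a < y" "h \<le> x" for a x
      using k[OF that(1)] h'(3)[OF that(1)] that(2) by simp
    moreover have "y < h" using u(2) h'(1) by simp
    ultimately show ?thesis using u h'(1,2) by blast
  qed
  then obtain H where H: "\<And>y. y < H y" "\<And>y. \<exists>u\<in>X1. y < u \<and> u < H y" "\<And>y. \<exists>u\<in>X2. y < u \<and> u < H y"
    "\<And>y a x. a < y \<Longrightarrow> H y \<le> x \<Longrightarrow> f (j (a, x, y)) = f (j (succ a, y, y))"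
    by metis
  define Z where "Z n = (H ^^ n) origin" for n
  have ZS: "Z (Suc n) = H (Z n)" for n by (simp add: Z_def)
  obtain y where y: "\<And>n. Z n < y" "\<And>w. w < y \<Longrightarrow> eventually (\<lambda>n. w < Z n) sequentially"
    using strict_seq_limit_omega1[of Z] H(1) ZS by metis
  have cof: "\<exists>u\<in>X. w < u \<and> u < y" if "w < y" "\<And>y. \<exists>u\<in>X. y < u \<and> u < H y" for w X
  proof -
    have "\<exists>n. w < Z n" using y(2)[OF that(1)] by (auto simp: eventually_sequentially)
    then obtain n where "w < Z n" ..
    moreover have "\<exists>u\<in>X. Z n < u \<and> u < H (Z n)" by (rule that(2))
    moreover have "H (Z n) < y" using y(1)[of "Suc n"] ZS by simp
    ultimately show ?thesis by (meson less_trans)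
  qed
  have "f (j (a, x, Z n)) = f (j (succ a, Z n, Z n))" if "a < Z n" "y \<le> x" for n a x
    using H(4)[OF that(1)] y(1)[of "Suc n"] that(2) ZS by simp
  then have "f (j (a, x, y)) = f (j (origin, y, y))" if "(a, x, y) \<in> plank" for a x
    using row_const[OF f y] that by blast
  moreover have "origin < y" using y(1)[of 0] by (simp add: Z_def)
  ultimately show ?thesis using that cof H(2,3) by blast
qed

section \<open>Functional narrowness\<close>

text \<open>A tube argument: the compact set \<open>rows y\<close> is covered by \<open>W\<close>
  and the earlier \<open>rows v\<close>, which are open and increasing, so beyond some
  \<open>b < y\<close> only \<open>W\<close> is left to cover.\<close>

lemma open_row_strip:
  assumes W: "openin Y W" "\<And>a x. (a, x, y) \<in> plank \<Longrightarrow> j (a, x, y) \<in> W"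
    and "b0 < y"
  obtains b where "b < y" "\<And>a x v. (a, x, v) \<in> plank \<Longrightarrow> b < v \<Longrightarrow> v \<le> y \<Longrightarrow> j (a, x, v) \<in> W"
proof -
  have "rows y \<subseteq> \<Union>(insert W (rows ` {..<y}))"
  proof
    fix u assume u: "u \<in> rows y"
    then have "u \<in> j ` plank" using rows_subset by blast
    then obtain a x v where p: "u = j (a, x, v)" "(a, x, v) \<in> plank" by (rule mem_plankE)
    then have "v \<le> y" using u by (simp add: j_mem_rows)
    show "u \<in> \<Union>(insert W (rows ` {..<y}))"
    proof (cases "v = y")
      case True
      then show ?thesis using W(2) p by auto
    next
      case False
      then have "u \<in> rows v" "v < y" using p \<open>v \<le> y\<close> by (auto simp: j_mem_rows)
      then show ?thesis by blast
    qed
  qed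
  moreover have "openin Y U" if "U \<in> insert W (rows ` {..<y})" for U
    using that W(1) openin_rows by blast
  ultimately obtain \<F> where \<F>: "finite \<F>" "\<F> \<subseteq> insert W (rows ` {..<y})" "rows y \<subseteq> \<Union>\<F>"
    using compactinD[OF compactin_rows, of "insert W (rows ` {..<y})" y] by blast
  then have "finite (\<F> - {W})" "\<F> - {W} \<subseteq> rows ` {..<y}" by auto
  then obtain B where B: "B \<subseteq> {..<y}" "finite B" "\<F> - {W} = rows ` B"
    by (meson finite_subset_image)
  \<comment> \<open>\<open>b0\<close> keeps the maximum defined, and below \<open>y\<close>, when
    \<open>B\<close> is empty.\<close>
  define b where "b = Max (insert b0 B)"
  have "b < y" using B \<open>b0 < y\<close> by (auto simp: b_def)
  moreover have "j (a, x, v) \<in> W" if p: "(a, x, v) \<in> plank" "b < v" "v \<le> y" for a x v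
  proof (rule ccontr)
    assume "j (a, x, v) \<notin> W"
    moreover have "j (a, x, v) \<in> rows y" using p by (simp add: j_mem_rows)
    then have "j (a, x, v) \<in> \<Union>\<F>" using \<F>(3) by blast
    ultimately obtain d where "d \<in> B" "j (a, x, v) \<in> rows d" using B(3) by blast
    then have "v \<le> d" "d \<le> b" using B(2) by (auto simp: j_mem_rows b_def)
    then show False using \<open>b < v\<close> by simp
  qed
  ultimately show ?thesis using that by blast
qed

lemma f_narrow_plank: "f_narrow_in_itself Y"
  unfolding f_narrow_in_itself_def
proof (intro allI impI)
  fix f :: "'p \<Rightarrow> longray" assume f: "continuous_map Y euclidean f"
  have "Lindelof_space (subtopology Y {y \<in> topspace Y. f y \<in> {..l}})"
    if nb: "\<not> bounded_into_longray Y f" for l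
  proof (rule ccontr)
    assume nL: "\<not> ?thesis"
    obtain m where "l < m" using ex_greater_longray by blast
    define X1 where "X1 = {y. \<exists>a x. (a, x, y) \<in> plank \<and> m \<le> f (j (a, x, y))}"
    define X2 where "X2 = {y. \<exists>a x. (a, x, y) \<in> plank \<and> f (j (a, x, y)) \<le> l}"
    \<comment> \<open>Otherwise values \<open>\<ge> m\<close> occur only in the compact set
      \<open>rows b\<close>, where \<open>f\<close> is bounded, so \<open>f\<close> would be
      bounded.\<close>
    have X1: "\<exists>u\<in>X1. b < u" for b
    proof (rule ccontr)
      assume no: "\<not> ?thesis"
      obtain c where c: "f ` rows b \<subseteq> {..<c}"
        using compactin_image_longray_bounded[OF compactin_rows f] by blast
      have "f u < max m c" if "u \<in> j ` plank" for u
        using that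
      proof (rule mem_plankE)
        fix a x y assume u: "u = j (a, x, y)" "(a, x, y) \<in> plank"
        show ?thesis
        proof (cases "y \<le> b")
          case True
          then have "u \<in> rows b" using u by (simp add: j_mem_rows)
          then have "f u < c" using c by blast
          then show ?thesis by (simp add: less_max_iff_disj)
        next
          case False
          then have "y \<notin> X1" using no by (meson not_le)
          then have "\<not> m \<le> f u" using u unfolding X1_def by blast
          then show ?thesis by (simp add: less_max_iff_disj not_le)
        qed
      qed
      then have "f ` topspace Y \<subseteq> {..<max m c}" by auto
      then show False using nb unfolding bounded_into_longray_def by blast
    qed
    \<comment> \<open>Otherwise the closed preimage lies in \<open>rows b\<close> and is
      Lindelof.\<close>
    have X2: "\<exists>u\<in>X2. b < u" for b
    proof (rule ccontr)
      assume no: "\<not> ?thesis"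
      have "{y \<in> topspace Y. f y \<in> {..l}} \<subseteq> rows b"
      proof
        fix u assume "u \<in> {y \<in> topspace Y. f y \<in> {..l}}"
        then have "u \<in> j ` plank" "f u \<le> l" by auto
        then obtain a x y where u: "u = j (a, x, y)" "(a, x, y) \<in> plank" by (meson mem_plankE)
        then have "y \<in> X2" using \<open>f u \<le> l\<close> unfolding X2_def by blast
        then have "y \<le> b" using no by (meson not_le)
        then show "u \<in> rows b" using u by (simp add: j_mem_rows)
      qed
      moreover have "closedin Y {y \<in> topspace Y. f y \<in> {..l}}"
        by (rule closedin_continuous_map_preimage[OF f]) simp
      ultimately show False using nL Lindelof_if_subset_rows by blast
    qed
    obtain y where y: "\<And>w. w < y \<Longrightarrow> \<exists>u\<in>X1. w < u \<and> u < y" "\<And>w. w < y \<Longrightarrow> \<exists>u\<in>X2. w < u \<and> u < y"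
      "\<And>a x. (a, x, y) \<in> plank \<Longrightarrow> f (j (a, x, y)) = f (j (origin, y, y))" "origin < y"
      using ex_const_row[OF f X1 X2] by metis
    have mem: "j (a, x, y) \<in> {u \<in> topspace Y. f u \<in> V}"
      if "(a, x, y) \<in> plank" "f (j (origin, y, y)) \<in> V" for a x V
      using that y(3) by simp
    \<comment> \<open>If the constant value were below \<open>m\<close>, so would be all values on
      the rows just below \<open>y\<close>, among which are members of \<open>X1\<close>.\<close>
    have "m \<le> f (j (origin, y, y))"
    proof (rule ccontr)
      assume "\<not> ?thesis"
      then have e: "f (j (origin, y, y)) \<in> {..<m}" by simp
      have "openin Y {u \<in> topspace Y. f u \<in> {..<m}}"
        by (rule openin_continuous_map_preimage[OF f]) simp
      then obtain b where b: "b < y" "\<And>a x v. (a, x, v) \<in> plank \<Longrightarrow> b < v \<Longrightarrow> v \<le> y \<Longrightarrow>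
          j (a, x, v) \<in> {u \<in> topspace Y. f u \<in> {..<m}}"
        using open_row_strip[OF _ mem[OF _ e] y(4)] by blast
      obtain v where "v \<in> X1" "b < v" "v < y" using y(1)[OF b(1)] by blast
      then obtain a x where "(a, x, v) \<in> plank" "m \<le> f (j (a, x, v))" unfolding X1_def by blast
      then show False using b(2)[of a x v] \<open>b < v\<close> less_imp_le[OF \<open>v < y\<close>] by simp
    qed
    \<comment> \<open>The same argument with \<open>X2\<close> and values above
      \<open>l\<close>.\<close>
    moreover have "f (j (origin, y, y)) \<le> l"
    proof (rule ccontr)
      assume "\<not> ?thesis"
      then have e: "f (j (origin, y, y)) \<in> {l<..}" by simp
      have "openin Y {u \<in> topspace Y. f u \<in> {l<..}}"
        by (rule openin_continuous_map_preimage[OF f]) simp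
      then obtain b where b: "b < y" "\<And>a x v. (a, x, v) \<in> plank \<Longrightarrow> b < v \<Longrightarrow> v \<le> y \<Longrightarrow>
          j (a, x, v) \<in> {u \<in> topspace Y. f u \<in> {l<..}}"
        using open_row_strip[OF _ mem[OF _ e] y(4)] by blast
      obtain v where "v \<in> X2" "b < v" "v < y" using y(2)[OF b(1)] by blast
      then obtain a x where "(a, x, v) \<in> plank" "f (j (a, x, v)) \<le> l" unfolding X2_def by blast
      then show False using b(2)[of a x v] \<open>b < v\<close> less_imp_le[OF \<open>v < y\<close>] by simp
    qed
    ultimately show False using \<open>l < m\<close> by simp
  qed
  then show "bounded_into_longray Y f \<or>
      (\<forall>\<alpha>. Lindelof_space (subtopology Y {y \<in> topspace Y. f y \<in> {..longray_of \<alpha>}}))"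
    by blast
qed

end

theorem mainTheorem3:
  shows "\<exists>Y :: real set topology.
    Type_I Y \<and> tychonoff_space Y \<and> countably_compact_space Y \<and> locally_compact_space Y \<and>
    f_narrow_in_itself Y \<and> \<not> narrow_in_itself Y"
proof -
  obtain j :: "omega1 \<times> omega1 \<times> omega1 \<Rightarrow> real set" where "inj j"
    using ex_inj_omega1_triples by blast
  then interpret plank_copy j by unfold_locales
  show ?thesis
    using Type_I_plank tychonoff_ideal countably_compact_plank locally_compact_ideal
      f_narrow_plank not_narrow_plank by blast
qed

end
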